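(* For every $(a,b,c)\in\mathbb Q^3$ there exists a $p'=p'(a,b,c)>\frac3{20}$ such that for every $p\in(0,1)$ with $p<p'$ the set $\mathrm{proj}_{(a,b,c)}(\mathcal M_p)\subset\mathbb R$ has one-dimensional Lebesgue measure $0$ almost surely.
   Context: Projection: $\mathrm{proj}_{(a,b,c)}:\mathbb R^3\to\mathbb R$, $\mathrm{proj}_{(a,b,c)}(x,y,z)=ax+by+cz$. Random Menger sponge with parameter $p\in(0,1)$: let $T$ be the set of the $20$ vectors obtained from $\{0,\frac13,\frac23\}^3$ by removing the $7$ vectors having at least two coordinates equal to $\frac13$. Let $f_t(x)=\frac13x+t$ on $\mathbb R^3$ for $t\in T$, and $f_{t_1\dots t_n}=f_{t_1}\circ\dots\circ f_{t_n}$. Give each nonempty finite word over $T$ an independent Bernoulli($p$) label, and let $\mathcal E_n\subset T^n$ be the random set of words $t_1\dots t_n$ such that all of $t_1,\ t_1t_2,\dots,\ t_1\dots t_n$ have label $1$. Then $\mathcal M_p:=\bigcap_{n\ge1}\bigcup_{\mathbf t\in\mathcal E_n}f_{\mathbf t}([0,1]^3)$. *)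

theory Defs
  imports "HOL-Probability.Probability"
begin

definition proj3 :: "real \<Rightarrow> real \<Rightarrow> real \<Rightarrow> real ^ 3 \<Rightarrow> real" where
  "proj3 a b c v = a * v $ 1 + b * v $ 2 + c * v $ 3"

definition menger_digits :: "(real ^ 3) set" where
  "menger_digits =
     {t. (\<forall>i. t $ i \<in> {0, 1/3, 2/3}) \<and> \<not> 2 \<le> card {i. t $ i = 1/3}}"

definition menger_map :: "real ^ 3 \<Rightarrow> real ^ 3 \<Rightarrow> real ^ 3" where
  "menger_map t x = (1/3) *\<^sub>R x + t"

definition menger_word_map :: "(real ^ 3) list \<Rightarrow> real ^ 3 \<Rightarrow> real ^ 3" where
  "menger_word_map w = foldr (\<lambda>t g. menger_map t \<circ> g) w id"

definition menger_words :: "(real ^ 3) list set" where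
  "menger_words = {w. w \<noteq> [] \<and> set w \<subseteq> menger_digits}"

(* The canonical probability space of the labels: an outcome assigns a label to every
   nonempty finite word (True is label 1), the labels being independent and Bernoulli(p). *)
definition menger_labels :: "real \<Rightarrow> ((real ^ 3) list \<Rightarrow> bool) measure" where
  "menger_labels p = PiM menger_words (\<lambda>_. measure_pmf (bernoulli_pmf p))"

definition menger_retained :: "((real ^ 3) list \<Rightarrow> bool) \<Rightarrow> nat \<Rightarrow> (real ^ 3) list set" where
  "menger_retained \<omega> n =
     {w. length w = n \<and> set w \<subseteq> menger_digits \<and> (\<forall>k\<in>{1..n}. \<omega> (take k w))}"

(* In real^3, cbox 0 1 is the unit cube, since 1 is the vector (1,1,1). *)
definition random_menger_sponge :: "((real ^ 3) list \<Rightarrow> bool) \<Rightarrow> (real ^ 3) set" where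
  "random_menger_sponge \<omega> =
     (\<Inter>n\<in>{1..}. \<Union>w\<in>menger_retained \<omega> n. menger_word_map w ` cbox 0 1)"

end

theory Submission imports Defs begin

text \<open>
  After scaling to integers, a level-n cube projects to an interval of length comparable to
  3^-n whose position is the integer val3 d w, the ternary value of the word of projected digits
  (nonnegative after a translation). If N(k) words have value k, then the position k survives with
  probability at most min 1 (p^n N(k)), hence at most (p^n N(k)) powr \<theta> for every \<theta> in (0,1), and the
  expected measure of the projection is at most a constant times 3^-n p^(n\<theta>) S(n), where
  S(n) is the sum of N(k) powr \<theta>. Since S is submultiplicative, it suffices to find a single n
  with S(n) < 3^n (20/3)^(n\<theta>), because this leaves room beyond p = 3/20.

  Up to a constant, Hoelder's inequality gives S(n) \<le> 3^n (20/3)^(n\<theta>); the constant is beaten because the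
  projected self-similar measure is singular. Its Fourier coefficients along k, 3k, 9k, ...
  all equal one number, which is nonzero for a suitable integer k: otherwise a product of digit
  polynomials would vanish at all primitive roots of unity of order 3^n and so be divisible over the
  integers by the cyclotomic polynomial, whose value 3 at 1 does not divide a power of 20. Correlating with these
  orthogonal characters yields sets of residues mod 3^n of vanishing density that carry a fixed
  proportion of all words, and splitting Hoelder's inequality over such a set gives the strict bound.
\<close>

section \<open>Ternary values of words\<close>

definition words :: "'a set \<Rightarrow> nat \<Rightarrow> 'a list set" where
  "words T n = {w. length w = n \<and> set w \<subseteq> T}"

text \<open>Digits above 2 are allowed, so distinct words can share a value: these are the exact
  overlaps of projected cubes. The first letter has the largest weight because it indexes the
  outermost map.\<close>

fun val3 :: "('a \<Rightarrow> nat) \<Rightarrow> 'a list \<Rightarrow> nat" where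
  "val3 d [] = 0"
| "val3 d (t # w) = d t * 3 ^ length w + val3 d w"

lemma val3_append: "val3 d (u @ v) = val3 d u * 3 ^ length v + val3 d v"
  by (induction u) (auto simp: algebra_simps power_add)

lemma finite_words: "finite T \<Longrightarrow> finite (words T n)"
  unfolding words_def using finite_lists_length_eq[of T n] by (simp add: conj_commute)

lemma card_words: "finite T \<Longrightarrow> card (words T n) = card T ^ n"
  unfolding words_def using card_lists_length_eq[of T n] by (simp add: conj_commute)

lemma words_Suc: "words T (Suc n) = (\<lambda>(t, w). t # w) ` (T \<times> words T n)"
  by (auto simp: words_def length_Suc_conv image_iff)

lemma words_add: "words T (m + n) = (\<lambda>(u, v). u @ v) ` (words T m \<times> words T n)"
proof -
  have "w \<in> (\<lambda>(u, v). u @ v) ` (words T m \<times> words T n)" if "w \<in> words T (m + n)" for w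
    using that set_take_subset[of m w] set_drop_subset[of m w]
    by (intro image_eqI[of _ _ "(take m w, drop m w)"]) (auto simp: words_def)
  then show ?thesis by (auto simp: words_def)
qed

lemma inj_append_words: "inj_on (\<lambda>(u, v). u @ v) (words T m \<times> words T n)"
  by (auto simp: inj_on_def words_def)

lemma sum_words_power:
  fixes z :: "'b::comm_semiring_1"
  shows "(\<Sum>w\<in>words T n. z ^ val3 d w) = (\<Prod>i<n. \<Sum>t\<in>T. (z ^ 3 ^ i) ^ d t)"
proof (induction n)
  case 0
  have "words T 0 = {[]}" by (auto simp: words_def)
  then show ?case by simp
next
  case (Suc n)
  have "(\<Sum>w\<in>words T (Suc n). z ^ val3 d w) = (\<Sum>(t, w)\<in>T \<times> words T n. z ^ val3 d (t # w))"
    unfolding words_Suc by (subst sum.reindex) (auto simp: inj_on_def case_prod_beta)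
  also have "\<dots> = (\<Sum>(t, w)\<in>T \<times> words T n. (z ^ 3 ^ n) ^ d t * z ^ val3 d w)"
    by (intro sum.cong) (auto simp: words_def power_add simp flip: power_mult, simp add: mult.commute)
  also have "\<dots> = (\<Sum>t\<in>T. (z ^ 3 ^ n) ^ d t) * (\<Sum>w\<in>words T n. z ^ val3 d w)"
    by (simp add: sum_product sum.cartesian_product)
  finally show ?case by (simp add: Suc.IH mult.commute)
qed

lemma val3_less:
  assumes "\<And>t. t \<in> T \<Longrightarrow> d t \<le> D" "w \<in> words T n"
  shows "val3 d w < (D + 1) * 3 ^ n"
proof -
  have "val3 d w + D + 1 \<le> (D + 1) * 3 ^ length w" if "set w \<subseteq> T" for w
    using that
  proof (induction w)
    case (Cons t w)
    have "d t * 3 ^ length w \<le> D * 3 ^ length w" using Cons assms(1) by auto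
    moreover have "val3 d w + D + 1 \<le> D * 3 ^ length w + 3 ^ length w"
      using Cons by (simp add: algebra_simps)
    ultimately have "val3 d (t # w) + D + 1 \<le> 2 * (D * 3 ^ length w) + 3 ^ length w"
      unfolding val3.simps by linarith
    also have "\<dots> \<le> (D + 1) * 3 ^ length (t # w)" by (simp add: algebra_simps)
    finally show ?case .
  qed auto
  from this[of w] show ?thesis using assms(2) by (auto simp: words_def)
qed

section \<open>Roots of unity of order a power of 3\<close>

definition root3 :: "nat \<Rightarrow> nat \<Rightarrow> complex" where
  "root3 k l = cis (2 * pi * real k / 3 ^ l)"

lemma root3_power: "root3 k (l + j) ^ 3 ^ j = root3 k l"
  by (simp add: root3_def Complex.DeMoivre power_add)

lemma root3_eq_1: "l \<le> j \<Longrightarrow> root3 k l ^ 3 ^ j = 1"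
proof -
  assume "l \<le> j"
  then have eq: "(3::nat) ^ j = 3 ^ l * 3 ^ (j - l)" by (metis le_add_diff_inverse power_add)
  have "root3 k l ^ 3 ^ l = 1" using root3_power[of k 0 l] by (simp add: root3_def)
  then show ?thesis unfolding eq power_mult by simp
qed

text \<open>Raising to the missing power of 3 would give \<open>root3 k 1 = 1\<close>, which forces
  3 to divide \<open>k\<close>. Together with \<open>root3_eq_1\<close>, the order of
  \<open>root3 k l\<close> is therefore exactly \<open>3 ^ l\<close>.\<close>

lemma root3_neq_1:
  assumes "\<not> 3 dvd k" "l > j"
  shows "root3 k l ^ 3 ^ j \<noteq> 1"
proof
  assume "root3 k l ^ 3 ^ j = 1"
  then have "root3 k (1 + (l - 1)) ^ 3 ^ (l - 1) = 1"
  proof -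
    have "j + (l - 1 - j) = l - 1" "1 + (l - 1) = l" using assms(2) by auto
    then show ?thesis using \<open>root3 k l ^ 3 ^ j = 1\<close> by (metis power_add power_mult power_one)
  qed
  then have "root3 k 1 = 1" by (simp only: root3_power)
  then obtain i :: int where "2 * pi * real k / 3 = 2 * pi * of_int i"
    unfolding root3_def by (auto simp: cis_conv_exp exp_eq_1 mult_ac)
  then have "real k = 3 * of_int i" by simp
  then have "int k = 3 * i" by linarith
  then show False using assms(1) by presburger
qed

section \<open>Singularity of the digit distribution\<close>

text \<open>Division by 1 + x^m + x^(2m), the cyclotomic polynomial when m is a power of 3.\<close>

lemma three_dvd_poly_one:
  fixes Q :: "complex poly"
  assumes int: "\<And>i. coeff Q i \<in> \<int>" and m: "m > 0"
    and roots: "\<And>z. z ^ (3 * m) = 1 \<Longrightarrow> z ^ m \<noteq> 1 \<Longrightarrow> poly Q z = 0"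
  shows "\<exists>h::int. poly Q 1 = 3 * of_int h"
proof -
  define F :: "complex poly" where "F = 1 + monom 1 m + monom 1 (2 * m)"
  have F_root: "poly F z = 0" if "z ^ (3 * m) = 1" "z ^ m \<noteq> 1" for z
  proof -
    have "(z ^ m - 1) * poly F z = z ^ (3 * m) - 1"
      by (simp add: F_def poly_monom algebra_simps numeral_3_eq_3 power_add mult_2_right)
    then show ?thesis using that by simp
  qed
  have degF: "degree F = 2 * m"
  proof -
    have "degree (1 + monom (1::complex) m) < degree (monom (1::complex) (2 * m))"
      using m by (intro le_less_trans[OF degree_add_le_max]) (auto simp: degree_monom_eq)
    then show ?thesis
      unfolding F_def by (subst degree_add_eq_right) (auto simp: degree_monom_eq)
  qed
  \<comment> \<open>\<open>Z\<close> collects \<open>2 * m\<close> distinct roots of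
    \<open>F\<close>, as many as its degree; a remainder of smaller degree that vanishes on
    \<open>Z\<close> must be zero.\<close>
  define Z where "Z = {z::complex. z ^ (3 * m) = 1} - {z. z ^ m = 1}"
  have cardZ: "card Z = 2 * m" and finZ: "finite Z"
  proof -
    have "{z::complex. z ^ m = 1} \<subseteq> {z. z ^ (3 * m) = 1}"
      by (auto simp: power_mult mult.commute[of 3])
    moreover have "finite {z::complex. z ^ m = 1}" "finite {z::complex. z ^ (3 * m) = 1}"
      using m by (auto intro!: finite_roots_unity)
    ultimately show "card Z = 2 * m" "finite Z"
      using m by (auto simp: Z_def card_Diff_subset card_roots_unity_eq)
  qed
  have "Q mod F = 0"
  proof (rule ccontr)
    assume nz: "Q mod F \<noteq> 0"
    have "poly (Q mod F) z = 0" if "z \<in> Z" for z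
    proof -
      have "poly Q z = poly (Q div F) z * poly F z + poly (Q mod F) z"
        by (metis div_mult_mod_eq poly_add poly_mult)
      then show ?thesis using that roots[of z] F_root[of z] by (auto simp: Z_def)
    qed
    then have "card Z \<le> card {z. poly (Q mod F) z = 0}"
      by (intro card_mono poly_roots_finite nz) auto
    also have "\<dots> \<le> degree (Q mod F)" by (rule card_poly_roots_bound[OF nz])
    also have "\<dots> < 2 * m" using degree_mod_less'[of F Q] nz degF m by (metis degree_0 less_irrefl mult_is_0 neq0_conv zero_neq_numeral)
    finally show False using cardZ by simp
  qed
  then obtain H where H: "Q = F * H" by (auto elim: dvdE simp: mod_eq_0_iff_dvd)
  \<comment> \<open>\<open>F\<close> has constant coefficient 1, so comparing coefficients from the
    bottom up expresses those of \<open>H\<close> through integers. The factor 3 in the conclusion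
    is then \<open>poly F 1\<close>.\<close>
  have H_int: "coeff H i \<in> \<int>" for i
  proof (induction i rule: less_induct)
    case (less i)
    have "coeff Q i = coeff H i + (if i < m then 0 else coeff H (i - m))
            + (if i < 2 * m then 0 else coeff H (i - 2 * m))"
      unfolding H F_def by (simp only: distrib_right coeff_add coeff_monom_mult mult_1)
    then have "coeff H i = coeff Q i - (if i < m then 0 else coeff H (i - m))
            - (if i < 2 * m then 0 else coeff H (i - 2 * m))" by simp
    also have "\<dots> \<in> \<int>" using m less int by (intro Ints_diff) auto
    finally show ?case .
  qed
  have "poly H 1 \<in> \<int>" by (auto simp: poly_altdef intro!: Ints_sum H_int)
  then obtain h where "poly H 1 = of_int h" by (auto elim: Ints_cases)
  then show ?thesis by (intro exI[of _ h]) (simp add: H F_def poly_monom)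
qed

text \<open>The argument works for any finite digit set whose cardinality is prime to 3, with 20 the
  case of the sponge. Repeated digits are encoded by letters of \<open>T\<close> with the same
  \<open>d\<close>.\<close>

locale digit_system =
  fixes T :: "'a set" and d :: "'a \<Rightarrow> nat"
  assumes fin: "finite T" and not_dvd: "\<not> 3 dvd card T"
begin

definition P :: "complex \<Rightarrow> complex" where
  "P z = (\<Sum>t\<in>T. z ^ d t)"

lemma card_pos: "card T > 0"
  using not_dvd by (cases "card T = 0") auto

lemma P_1: "P 1 = of_nat (card T)"
  by (simp add: P_def)

lemma sum_words_P: "(\<Sum>w\<in>words T n. z ^ val3 d w) = (\<Prod>i<n. P (z ^ 3 ^ i))"
  unfolding P_def by (rule sum_words_power)

text \<open>If the product over \<open>n\<close> positions is nonzero at one primitive root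
  \<open>z\<close> of order \<open>3 ^ n\<close>, then \<open>P\<close> is nonzero at the iterated
  cubes of \<open>z\<close>, which pass through all levels from \<open>n\<close> down to 1. Larger
  levels are harmless once \<open>n\<close> exceeds the level of each of the finitely many zeros of
  \<open>P\<close>.\<close>

lemma exists_nonvanishing_frequency:
  "\<exists>k. \<not> 3 dvd k \<and> (\<forall>l. P (root3 k l) \<noteq> 0)"
proof -
  define p :: "complex poly" where "p = (\<Sum>t\<in>T. monom 1 (d t))"
  have poly_p: "poly p z = P z" for z by (simp add: p_def P_def poly_sum poly_monom)
  have "p \<noteq> 0" using poly_p[of 1] P_1 card_pos by auto
  then have finZ: "finite {z. P z = 0}" using poly_roots_finite[of p] poly_p by simp
  define lev :: "complex \<Rightarrow> nat" where "lev z = (LEAST l. z ^ 3 ^ l = 1)" for z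
  have lev_root3: "lev (root3 k l) = l" if "\<not> 3 dvd k" for k l
    unfolding lev_def using that
    by (intro Least_equality root3_eq_1) (auto intro: leI dest: root3_neq_1)
  \<comment> \<open>The inserted 0 covers the case that \<open>P\<close> has no zeros. Zeros that
    are not roots of unity of 3-power order get an unspecified level, which can only enlarge
    \<open>n\<close>.\<close>
  define n where "n = Suc (Max (insert 0 (lev ` {z. P z = 0})))"
  have lev_less: "lev z < n" if "P z = 0" for z
    unfolding n_def using finZ that by (intro le_imp_less_Suc Max_ge) auto
  define m :: nat where "m = 3 ^ (n - 1)"
  have m: "3 * m = 3 ^ n" by (simp add: m_def n_def)
  define Q :: "complex poly" where "Q = (\<Sum>w\<in>words T n. monom 1 (val3 d w))"
  have poly_Q: "poly Q z = (\<Prod>i<n. P (z ^ 3 ^ i))" for z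
    unfolding sum_words_P[symmetric] by (simp add: Q_def poly_sum poly_monom)
  \<comment> \<open>Otherwise \<open>three_dvd_poly_one\<close> would make 3 divide the value of
    \<open>Q\<close> at 1, which is \<open>card T ^ n\<close>.\<close>
  have "\<exists>z. z ^ (3 * m) = 1 \<and> z ^ m \<noteq> 1 \<and> poly Q z \<noteq> 0"
  proof (rule ccontr)
    assume "\<not> ?thesis"
    moreover have "coeff Q i \<in> \<int>" for i unfolding Q_def coeff_sum by (intro Ints_sum) auto
    moreover have "m > 0" by (simp add: m_def)
    ultimately obtain h :: int where "poly Q 1 = 3 * of_int h"
      using three_dvd_poly_one[of Q m] by blast
    then have "complex_of_int (int (card T ^ n)) = of_int (3 * h)"
      by (simp add: poly_Q P_1)
    then have "int (card T ^ n) = 3 * h" by (simp only: of_int_eq_iff)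
    then have "3 dvd card T ^ n" by presburger
    then show False using not_dvd prime_dvd_power[of 3 "card T" n] by auto
  qed
  then obtain z where z: "z ^ 3 ^ n = 1" "z ^ m \<noteq> 1" "poly Q z \<noteq> 0" unfolding m by auto
  then obtain k where k: "z = root3 k n"
    using bij_betw_imp_surj_on[OF Complex.bij_betw_roots_unity[of "3 ^ n"]]
    by (auto simp: root3_def image_iff set_eq_iff)
  have nd: "\<not> 3 dvd k"
  proof
    assume "3 dvd k"
    then obtain k' where "k = 3 * k'" by (auto elim: dvdE)
    then have "root3 k n = root3 k' (0 + (n - 1))"
      by (simp add: root3_def n_def mult.assoc)
    then show False using z(2) k unfolding m_def by (metis add_0 le_refl root3_eq_1)
  qed
  have "P (root3 k l) \<noteq> 0" for l
  proof (cases "l < n")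
    case True
    show ?thesis
    proof (cases "l = 0")
      case True
      then show ?thesis using P_1 card_pos by (simp add: root3_def)
    next
      case False
      have "root3 k l = z ^ 3 ^ (n - l)" using root3_power[of k l "n - l"] True k by simp
      moreover have "P (z ^ 3 ^ (n - l)) \<noteq> 0" using z(3) True False by (auto simp: poly_Q)
      ultimately show ?thesis by simp
    qed
  next
    case False
    then show ?thesis using lev_less[of "root3 k l"] lev_root3[OF nd] by auto
  qed
  with nd show ?thesis by blast
qed

section \<open>Fourier coefficients of the digit distribution\<close>

lemma norm_root3 [simp]: "norm (root3 k l) = 1"
  by (simp add: root3_def)

lemma norm_root3_minus_1: "norm (root3 k l - 1) \<le> 2 * pi * k / 3 ^ l"
proof -
  have "norm (cis x - 1) \<le> \<bar>x\<bar>" for x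
    using abs_sin_x_le_abs_x[of "x / 2"] by (simp add: cis_conv_exp dist_exp_i_1)
  from this[of "2 * pi * k / 3 ^ l"] show ?thesis by (simp add: root3_def)
qed

text \<open>A partial product of the Fourier transform, at the integer \<open>k\<close>, of the law
  of a random series: its term number \<open>l \<ge> 1\<close> is \<open>d t / 3 ^ l\<close>, with
  independent uniform letters \<open>t\<close>.\<close>

definition \<Phi> :: "nat \<Rightarrow> nat \<Rightarrow> complex" where
  "\<Phi> k m = (\<Prod>l<m. P (root3 k (Suc l)) / of_nat (card T))"

text \<open>The factors approach 1 geometrically, so the infinite product converges absolutely; as
  no factor vanishes, its limit is nonzero.\<close>

lemma Phi_lower_bound:
  assumes nz: "\<And>l. P (root3 k l) \<noteq> 0"
  shows "\<exists>\<delta>>0. \<forall>m. \<delta> \<le> norm (\<Phi> k m)"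
proof -
  define M where "M = card T"
  have M: "M > 0" using card_pos by (simp add: M_def)
  define f where "f l = P (root3 k (Suc l)) / of_nat M" for l
  define C where "C = (\<Sum>t\<in>T. real (d t)) * (2 * pi * k) / M"
  have bound: "norm (f l - 1) \<le> C * (1/3) ^ Suc l" for l
  proof -
    let ?z = "root3 k (Suc l)"
    have "f l - 1 = (\<Sum>t\<in>T. ?z ^ d t - 1) / of_nat M"
      using M by (simp add: f_def P_def M_def sum_subtractf field_simps)
    then have "norm (f l - 1) = norm (\<Sum>t\<in>T. ?z ^ d t - 1) / M"
      by (simp add: norm_divide)
    also have "\<dots> \<le> (\<Sum>t\<in>T. real (d t) * (2 * pi * k / 3 ^ Suc l)) / M"
    proof (intro divide_right_mono sum_norm_le)
      fix t
      have "norm (?z ^ d t - 1 ^ d t) \<le> d t * norm (?z - 1)"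
        by (rule norm_power_diff) auto
      also have "\<dots> \<le> real (d t) * (2 * pi * k / 3 ^ Suc l)"
        by (intro mult_left_mono norm_root3_minus_1) auto
      finally show "norm (?z ^ d t - 1) \<le> real (d t) * (2 * pi * k / 3 ^ Suc l)" by simp
    qed auto
    also have "\<dots> = C * (1/3) ^ Suc l"
      by (simp add: C_def sum_distrib_right power_divide sum_divide_distrib mult.commute)
    finally show ?thesis .
  qed
  have "summable (\<lambda>l. C * (1/3) ^ Suc l)"
    by (intro summable_mult) (simp add: summable_Suc_iff summable_geometric)
  then have "summable (\<lambda>l. norm (f l - 1))"
    by (rule summable_comparison_test'[where N = 0]) (use bound in auto)
  then have "convergent_prod f"
    by (intro abs_convergent_prod_imp_convergent_prod summable_imp_abs_convergent_prod)
  moreover have "f l \<noteq> 0" for l using nz M by (simp add: f_def)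
  ultimately have lim: "(\<lambda>n. \<Prod>i\<le>n. f i) \<longlonglongrightarrow> prodinf f" "prodinf f \<noteq> 0"
    using convergent_prod_LIMSEQ prodinf_nonzero by blast+
  have Phi: "\<Phi> k m = (\<Prod>i<m. f i)" for m by (simp add: \<Phi>_def f_def M_def)
  have "(\<lambda>n. inverse (\<Phi> k (Suc n))) \<longlonglongrightarrow> inverse (prodinf f)"
    unfolding Phi lessThan_Suc_atMost by (intro tendsto_inverse lim)
  then have "(\<lambda>n. inverse (\<Phi> k n)) \<longlonglongrightarrow> inverse (prodinf f)"
    by (rule LIMSEQ_imp_Suc)
  \<comment> \<open>Boundedness of the convergent reciprocals gives one lower bound for all
    \<open>m\<close>, not only for large ones.\<close>
  then have "Bseq (\<lambda>n. inverse (\<Phi> k n))" by (intro convergent_imp_Bseq convergentI)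
  then obtain K where K: "K > 0" "\<And>n. norm (inverse (\<Phi> k n)) \<le> K" by (auto elim: BseqE)
  have "inverse K \<le> norm (\<Phi> k n)" for n
  proof -
    have "norm (\<Phi> k n) > 0" using nz M by (auto simp: Phi f_def)
    then show ?thesis using K(2)[of n] K(1) by (simp add: norm_inverse inverse_le_imp_le)
  qed
  then show ?thesis using K(1) by (intro exI[of _ "inverse K"]) auto
qed

lemma norm_Phi_le_1: "norm (\<Phi> k m) \<le> 1"
proof -
  have "norm (P z / of_nat (card T)) \<le> 1" if "norm z = 1" for z
  proof -
    have "norm (P z) \<le> (\<Sum>t\<in>T. 1)"
      unfolding P_def by (intro sum_norm_le) (simp add: norm_power that)
    then show ?thesis using card_pos by (simp add: norm_divide)
  qed
  then show ?thesis unfolding \<Phi>_def prod_norm[symmetric] by (intro prod_le_1) auto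
qed

text \<open>Positions \<open>i \<ge> m\<close> evaluate \<open>P\<close> at 1, and the others run
  through the levels \<open>m\<close> down to 1. Divided by the number of words, the coefficient
  thus does not depend on \<open>n\<close>.\<close>

lemma sum_words_root3:
  assumes "m \<le> n"
  shows "(\<Sum>w\<in>words T n. root3 k m ^ val3 d w) = of_nat (card T) ^ n * \<Phi> k m"
proof -
  have "(\<Sum>w\<in>words T n. root3 k m ^ val3 d w) = (\<Prod>i<n. P (root3 k m ^ 3 ^ i))"
    by (rule sum_words_P)
  also have "\<dots> = (\<Prod>i<m. P (root3 k m ^ 3 ^ i)) * (\<Prod>i=m..<n. P (root3 k m ^ 3 ^ i))"
    using prod.atLeastLessThan_concat[of 0 m n "\<lambda>i. P (root3 k m ^ 3 ^ i)"] assms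
    by (simp add: atLeast0LessThan)
  also have "(\<Prod>i=m..<n. P (root3 k m ^ 3 ^ i)) = of_nat (card T) ^ (n - m)"
    by (simp add: root3_eq_1 P_1)
  also have "(\<Prod>i<m. P (root3 k m ^ 3 ^ i)) = (\<Prod>i<m. P (root3 k (m - i)))"
    using root3_power[of k "m - i" i for i] by (intro prod.cong) (auto, metis add.commute le_add_diff_inverse less_imp_le)
  also have "\<dots> = (\<Prod>l<m. P (root3 k (Suc l)))"
    by (subst prod.nat_diff_reindex[symmetric]) (auto intro!: prod.cong simp: Suc_diff_Suc)
  also have "\<dots> = of_nat (card T) ^ m * \<Phi> k m"
    using card_pos by (simp add: \<Phi>_def prod_dividef)
  finally show ?thesis using assms by (simp add: mult_ac flip: power_add)
qed

text \<open>For different levels the ratio of the characters is a root of unity other than 1 with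
  order dividing \<open>3 ^ n\<close>, so the geometric sum vanishes.\<close>

lemma root3_orthogonal:
  assumes "\<not> 3 dvd k" "m \<le> n" "m' \<le> n"
  shows "(\<Sum>r<3^n. root3 k m ^ r * cnj (root3 k m' ^ r)) = (if m = m' then 3 ^ n else 0)"
proof -
  define z where "z = root3 k m * cnj (root3 k m')"
  have unit: "root3 k l * cnj (root3 k l) = 1" for l
    by (simp add: root3_def cis_cnj cis_mult)
  have eq: "root3 k m ^ r * cnj (root3 k m' ^ r) = z ^ r" for r
    by (simp add: z_def power_mult_distrib)
  show ?thesis
  proof (cases "m = m'")
    case True
    then show ?thesis unfolding eq by (simp add: z_def unit)
  next
    case False
    have "z \<noteq> 1"
    proof
      assume "z = 1"
      then have "root3 k m = root3 k m'"
        using unit[of m'] by (metis mult.assoc mult.commute mult_1 z_def)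
      moreover have "root3 k i \<noteq> root3 k j" if "i < j" for i j
        using root3_eq_1[of i i k] root3_neq_1[OF assms(1) that] by auto
      ultimately show False using False by (metis linorder_neqE_nat)
    qed
    moreover have "z ^ 3 ^ n = 1"
      using assms by (simp add: z_def power_mult_distrib root3_eq_1 flip: complex_cnj_power)
    ultimately show ?thesis unfolding eq using False by (simp add: sum_gp_strict)
  qed
qed

text \<open>A weighted average \<open>Y\<close> of \<open>n\<close> orthogonal characters has mean
  square at most \<open>1 / n\<close> over the residues, yet over the words the mean of its norm is
  at least \<open>\<delta>\<^sup>2\<close>. Hence the residues where \<open>Y\<close> is large are
  rare but carry a fixed share of the words.\<close>

lemma exceptional_residues:
  "\<exists>q>0. q < 1 \<and> (\<forall>n\<ge>1. \<exists>B\<subseteq>{..<3^n}. q\<^sup>2 * (real (card B) * n) \<le> 3 ^ n \<and>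
     q * card T ^ n \<le> card {w \<in> words T n. val3 d w mod 3 ^ n \<in> B})"
proof -
  obtain k where k: "\<not> 3 dvd k" "\<And>l. P (root3 k l) \<noteq> 0"
    using exists_nonvanishing_frequency by blast
  obtain \<delta> where \<delta>: "\<delta> > 0" "\<And>m. \<delta> \<le> norm (\<Phi> k m)"
    using Phi_lower_bound[OF k(2)] by blast
  have "\<delta> \<le> 1" using \<delta>(2) norm_Phi_le_1 order_trans by blast
  \<comment> \<open>Half the lower bound for the mean of the norm of \<open>Y\<close> over the
    words: the other half must come from words on which the norm reaches the threshold
    \<open>q\<close>.\<close>
  define q where "q = \<delta>\<^sup>2 / 2"
  have q: "q > 0" "q < 1" using \<delta>(1) \<open>\<delta> \<le> 1\<close> power_le_one[of \<delta> 2] by (auto simp: q_def)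
  have "\<exists>B\<subseteq>{..<3^n}. q\<^sup>2 * (real (card B) * n) \<le> 3 ^ n \<and>
     q * card T ^ n \<le> card {w \<in> words T n. val3 d w mod 3 ^ n \<in> B}" if n: "n \<ge> 1" for n
  proof -
    \<comment> \<open>The conjugate weights turn the contribution of each level to the sum over
      words into \<open>(norm (\<Phi> k m))\<^sup>2\<close> times a positive factor, so the levels
      cannot cancel.\<close>
    define Y where "Y r = (\<Sum>m=1..n. cnj (\<Phi> k m) * root3 k m ^ r) / of_nat n" for r
    have Y_mod: "Y (r mod 3 ^ n) = Y r" for r
    proof -
      have "root3 k m ^ r = root3 k m ^ (r mod 3 ^ n)" if "m \<le> n" for m
      proof -
        have "root3 k m ^ (3 ^ n * (r div 3 ^ n) + r mod 3 ^ n) = root3 k m ^ (r mod 3 ^ n)"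
          unfolding power_add power_mult using root3_eq_1[OF that] by simp
        then show ?thesis by simp
      qed
      then show ?thesis unfolding Y_def by (intro arg_cong2[where f = "(/)"] sum.cong) auto
    qed
    have Y_le: "norm (Y r) \<le> 1" for r
    proof -
      have "norm (\<Sum>m=1..n. cnj (\<Phi> k m) * root3 k m ^ r) \<le> (\<Sum>m=1..n. 1)"
        by (intro sum_norm_le) (simp add: norm_mult norm_power norm_Phi_le_1)
      then show ?thesis using n by (simp add: Y_def norm_divide)
    qed
    have mean: "card T ^ n * \<delta>\<^sup>2 \<le> (\<Sum>w\<in>words T n. norm (Y (val3 d w)))"
    proof -
      have "(\<Sum>w\<in>words T n. Y (val3 d w)) =
          (\<Sum>m=1..n. cnj (\<Phi> k m) * (\<Sum>w\<in>words T n. root3 k m ^ val3 d w)) / of_nat n"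
        unfolding Y_def sum_divide_distrib[symmetric] sum_distrib_left by (subst sum.swap) simp
      also have "\<dots> = (\<Sum>m=1..n. of_nat (card T) ^ n * of_real ((norm (\<Phi> k m))\<^sup>2)) / of_nat n"
        by (intro arg_cong2[where f = "(/)"] sum.cong)
          (auto simp: sum_words_root3 complex_norm_square mult_ac simp del: of_real_power)
      also have "\<dots> = of_real (card T ^ n * ((\<Sum>m=1..n. (norm (\<Phi> k m))\<^sup>2) / n))"
        by (simp add: sum_distrib_left)
      finally have "norm (\<Sum>w\<in>words T n. Y (val3 d w)) =
          card T ^ n * ((\<Sum>m=1..n. (norm (\<Phi> k m))\<^sup>2) / n)"
        by (simp only: norm_of_real) (simp add: sum_nonneg)
      moreover have "(\<Sum>m=1..n. \<delta>\<^sup>2) \<le> (\<Sum>m=1..n. (norm (\<Phi> k m))\<^sup>2)"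
        using \<delta> by (intro sum_mono power_mono) auto
      then have "\<delta>\<^sup>2 \<le> (\<Sum>m=1..n. (norm (\<Phi> k m))\<^sup>2) / n"
        using n by (simp add: field_simps)
      ultimately have "card T ^ n * \<delta>\<^sup>2 \<le> norm (\<Sum>w\<in>words T n. Y (val3 d w))"
        by (metis mult_left_mono of_nat_0_le_iff)
      also have "\<dots> \<le> (\<Sum>w\<in>words T n. norm (Y (val3 d w)))" by (rule norm_sum)
      finally show ?thesis .
    qed
    have square: "(\<Sum>r<3^n. (norm (Y r))\<^sup>2) \<le> 3 ^ n / n"
    proof -
      have "of_real (\<Sum>r<3^n. (norm (Y r))\<^sup>2) = (\<Sum>r<3^n. Y r * cnj (Y r))"
        by (simp only: of_real_sum complex_norm_square)
      also have "\<dots> = (\<Sum>r<3^n. \<Sum>m=1..n. \<Sum>m'=1..n. cnj (\<Phi> k m) * \<Phi> k m' *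
            (root3 k m ^ r * cnj (root3 k m' ^ r))) / (of_nat n)\<^sup>2"
        unfolding Y_def sum_divide_distrib[symmetric] complex_cnj_divide cnj_sum
          times_divide_times_eq sum_product power2_eq_square
        by (simp add: mult_ac)
      also have "(\<Sum>r<3^n. \<Sum>m=1..n. \<Sum>m'=1..n. cnj (\<Phi> k m) * \<Phi> k m' *
            (root3 k m ^ r * cnj (root3 k m' ^ r))) =
          (\<Sum>m=1..n. \<Sum>m'=1..n. cnj (\<Phi> k m) * \<Phi> k m' *
            (\<Sum>r<3^n. root3 k m ^ r * cnj (root3 k m' ^ r)))"
        unfolding sum_distrib_left by (subst sum.swap, rule sum.cong[OF refl], rule sum.swap)
      \<comment> \<open>Only the diagonal survives: \<open>n\<close> terms against the normalisation
        \<open>n\<^sup>2\<close> give the gain \<open>1 / n\<close>.\<close>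
      also have "\<dots> = (\<Sum>m=1..n. \<Sum>m'=1..n. if m = m' then cnj (\<Phi> k m) * \<Phi> k m' * 3 ^ n else 0)"
        by (intro sum.cong refl, subst root3_orthogonal[OF k(1)]) auto
      also have "\<dots> = (\<Sum>m=1..n. \<Phi> k m * cnj (\<Phi> k m) * 3 ^ n)"
        by (simp add: mult.commute)
      also have "\<dots> = of_real ((\<Sum>m=1..n. (norm (\<Phi> k m))\<^sup>2) * 3 ^ n)"
        by (simp only: complex_norm_square[symmetric] sum_distrib_right of_real_sum of_real_mult) simp
      finally have "of_real (\<Sum>r<3^n. (norm (Y r))\<^sup>2) =
          complex_of_real ((\<Sum>m=1..n. (norm (\<Phi> k m))\<^sup>2) * 3 ^ n / (real n)\<^sup>2)"
        by simp
      then have "(\<Sum>r<3^n. (norm (Y r))\<^sup>2) = (\<Sum>m=1..n. (norm (\<Phi> k m))\<^sup>2) * 3 ^ n / (real n)\<^sup>2"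
        by (simp only: of_real_eq_iff)
      also have "\<dots> \<le> (\<Sum>m=1..n. 1) * 3 ^ n / (real n)\<^sup>2"
        by (intro divide_right_mono mult_right_mono sum_mono) (auto simp: power_le_one norm_Phi_le_1)
      also have "\<dots> = 3 ^ n / n" using n by (simp add: power2_eq_square)
      finally show ?thesis .
    qed
    define B where "B = {r\<in>{..<3^n}. q \<le> norm (Y r)}"
    have "q\<^sup>2 * card B = (\<Sum>r\<in>B. q\<^sup>2)" by simp
    also have "\<dots> \<le> (\<Sum>r\<in>B. (norm (Y r))\<^sup>2)"
      using q by (intro sum_mono power_mono) (auto simp: B_def)
    also have "\<dots> \<le> (\<Sum>r<3^n. (norm (Y r))\<^sup>2)"
      by (intro sum_mono2) (auto simp: B_def)
    finally have "q\<^sup>2 * card B \<le> 3 ^ n / n" using square by simp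
    then have 1: "q\<^sup>2 * (real (card B) * n) \<le> 3 ^ n"
      using n by (simp add: field_simps)
    let ?G = "{w \<in> words T n. val3 d w mod 3 ^ n \<in> B}"
    have "card T ^ n * \<delta>\<^sup>2 \<le> (\<Sum>w\<in>words T n. norm (Y (val3 d w)))" by (rule mean)
    also have "\<dots> \<le> (\<Sum>w\<in>words T n. q + (if w \<in> ?G then 1 else 0))"
    proof (intro sum_mono)
      fix w assume w: "w \<in> words T n"
      show "norm (Y (val3 d w)) \<le> q + (if w \<in> ?G then 1 else 0)"
        using Y_mod[of "val3 d w"] Y_le[of "val3 d w"] q w by (auto simp: B_def)
    qed
    also have "\<dots> = card T ^ n * q + card ?G"
      by (simp add: sum.distrib card_words fin finite_words sum.If_cases Int_def)
    finally have "q * card T ^ n \<le> card ?G" by (simp add: q_def field_simps)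
    then show ?thesis using 1 by (intro exI[of _ B]) (auto simp: B_def)
  qed
  then show ?thesis using q by blast
qed

end

section \<open>Moments of the multiplicities\<close>

text \<open>For two terms, divide by their sum: a number in the unit interval is at most its power
  with exponent \<theta>. Induction does the rest.\<close>

lemma sum_powr_le_powr_sum:
  fixes f :: "'a \<Rightarrow> real"
  assumes "0 < \<theta>" "\<theta> \<le> 1" "\<And>i. i \<in> A \<Longrightarrow> 0 \<le> f i"
  shows "(\<Sum>i\<in>A. f i) powr \<theta> \<le> (\<Sum>i\<in>A. f i powr \<theta>)"
proof -
  have two: "(x + y) powr \<theta> \<le> x powr \<theta> + y powr \<theta>" if "0 \<le> x" "0 \<le> y" for x y :: real
  proof (cases "x + y = 0")
    case False
    define s where "s = x + y"
    have s: "s > 0" using False that by (simp add: s_def)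
    have "u / s \<le> (u / s) powr \<theta>" if "0 \<le> u" "u \<le> s" for u
      using powr_mono'[of \<theta> 1 "u / s"] assms(2) s that by simp
    from this[of x] this[of y] that have "x / s + y / s \<le> (x / s) powr \<theta> + (y / s) powr \<theta>"
      by (intro add_mono) (auto simp: s_def)
    moreover have "x / s + y / s = 1" using s by (simp add: s_def add_divide_distrib[symmetric])
    ultimately have "1 \<le> (x powr \<theta> + y powr \<theta>) / s powr \<theta>"
      using s that by (simp add: powr_divide add_divide_distrib)
    then show ?thesis using s by (simp add: s_def[symmetric])
  qed (use that in \<open>auto simp: add_nonneg_eq_0_iff\<close>)
  show ?thesis using assms(3)
  proof (induction A rule: infinite_finite_induct)
    case (insert a A)
    then show ?case
      using two[of "f a" "sum f A"] by (auto simp: sum_nonneg intro: order_trans)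
  qed (use assms in auto)
qed

text \<open>A form of Hoelder's inequality. Young's inequality supplies the tangent bound
  \<open>u powr \<theta> \<le> \<theta> * u + (1 - \<theta>)\<close>, applied to each
  \<open>f i\<close> divided by the mean \<open>c\<close>.\<close>

lemma sum_powr_le_card:
  fixes f :: "'a \<Rightarrow> real"
  assumes "finite A" "0 < \<theta>" "\<theta> < 1" "\<And>i. i \<in> A \<Longrightarrow> 0 \<le> f i"
  shows "(\<Sum>i\<in>A. f i powr \<theta>) \<le> real (card A) powr (1 - \<theta>) * (\<Sum>i\<in>A. f i) powr \<theta>"
proof (cases "sum f A = 0")
  case True
  then have "f i = 0" if "i \<in> A" for i
    using that assms(1,4) by (simp add: sum_nonneg_eq_0_iff)
  then show ?thesis by simp
next
  case False
  then have pos: "sum f A > 0" using assms(4) by (simp add: sum_nonneg order_less_le)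
  then have cA: "real (card A) > 0" using assms(1) by (cases "A = {}") (auto simp: card_gt_0_iff)
  define c where "c = sum f A / card A"
  have c: "c > 0" using pos cA by (simp add: c_def)
  have "f i powr \<theta> \<le> c powr \<theta> * (\<theta> * (f i / c) + (1 - \<theta>))" if "i \<in> A" for i
  proof -
    have "(f i / c) powr \<theta> \<le> \<theta> * (f i / c) + (1 - \<theta>)"
      using Youngs_inequality_0[of \<theta> "1 - \<theta>" "f i / c" 1] assms c that
      by (cases "f i = 0") (auto simp: order_less_le)
    then have "c powr \<theta> * (f i / c) powr \<theta> \<le> c powr \<theta> * (\<theta> * (f i / c) + (1 - \<theta>))"
      by (intro mult_left_mono) auto
    moreover have "c powr \<theta> * (f i / c) powr \<theta> = f i powr \<theta>"
      using c assms(4)[OF that] by (simp add: powr_divide)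
    ultimately show ?thesis by simp
  qed
  then have "(\<Sum>i\<in>A. f i powr \<theta>) \<le> (\<Sum>i\<in>A. c powr \<theta> * (\<theta> * (f i / c) + (1 - \<theta>)))"
    by (rule sum_mono)
  also have "\<dots> = c powr \<theta> * (\<theta> * (sum f A / c) + (1 - \<theta>) * card A)"
    by (simp add: sum_distrib_left[symmetric] sum.distrib sum_divide_distrib[symmetric] mult.commute)
  also have "sum f A / c = card A" using pos by (simp add: c_def)
  also have "c powr \<theta> * (\<theta> * card A + (1 - \<theta>) * card A) = c powr \<theta> * card A"
    by (simp add: algebra_simps)
  also have "\<dots> = real (card A) powr (1 - \<theta>) * (\<Sum>i\<in>A. f i) powr \<theta>"
    using cA pos by (simp add: c_def powr_divide powr_diff)
  finally show ?thesis .
qed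

section \<open>Submultiplicativity and the gain over Hoelder's inequality\<close>

context digit_system
begin

definition mult3 :: "nat \<Rightarrow> nat \<Rightarrow> nat" where
  "mult3 n k = card {w \<in> words T n. val3 d w = k}"

definition vals :: "nat \<Rightarrow> nat set" where
  "vals n = val3 d ` words T n"

text \<open>Interpolates between the number of attained values at \<open>\<theta> = 0\<close> and
  the number of words at \<open>\<theta> = 1\<close>.\<close>

definition S :: "real \<Rightarrow> nat \<Rightarrow> real" where
  "S \<theta> n = (\<Sum>k\<in>vals n. real (mult3 n k) powr \<theta>)"

lemma finite_vals: "finite (vals n)"
  by (simp add: vals_def finite_words fin)

lemma sum_words_val3:
  fixes h :: "nat \<Rightarrow> real"
  shows "(\<Sum>w\<in>words T n. h (val3 d w)) = (\<Sum>k\<in>vals n. mult3 n k * h k)"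
proof -
  have "(\<Sum>w\<in>words T n. h (val3 d w))
      = (\<Sum>k\<in>vals n. \<Sum>w\<in>{w\<in>words T n. val3 d w = k}. h (val3 d w))"
    unfolding vals_def by (rule sum.image_gen) (simp add: finite_words fin)
  also have "\<dots> = (\<Sum>k\<in>vals n. mult3 n k * h k)"
    by (intro sum.cong) (auto simp: mult3_def)
  finally show ?thesis .
qed

text \<open>Cutting words after \<open>m\<close> letters turns multiplicities into a convolution.
  The indicator inside a full double sum lets subadditivity of the power be applied to one sum after
  the other.\<close>

lemma mult3_add:
  "real (mult3 (m + n) k) =
     (\<Sum>i\<in>vals m. \<Sum>j\<in>vals n. real (mult3 m i) * real (mult3 n j) * (if i * 3 ^ n + j = k then 1 else 0))"
proof -
  define g :: "nat \<Rightarrow> real" where "g x = (if x = k then 1 else 0)" for x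
  have "real (mult3 (m + n) k) = (\<Sum>w\<in>words T (m + n). g (val3 d w))"
    by (simp add: mult3_def g_def sum.If_cases finite_words fin Int_def)
  also have "\<dots> = (\<Sum>(u, v)\<in>words T m \<times> words T n. g (val3 d (u @ v)))"
    unfolding words_add by (subst sum.reindex[OF inj_append_words]) (simp add: case_prod_beta)
  also have "\<dots> = (\<Sum>u\<in>words T m. \<Sum>v\<in>words T n. g (val3 d u * 3 ^ n + val3 d v))"
    unfolding sum.cartesian_product[symmetric]
    by (intro sum.cong) (auto simp: val3_append words_def)
  also have "\<dots> = (\<Sum>i\<in>vals m. \<Sum>j\<in>vals n. real (mult3 m i) * real (mult3 n j) * g (i * 3 ^ n + j))"
  proof -
    have "(\<Sum>u\<in>words T m. \<Sum>v\<in>words T n. g (val3 d u * 3 ^ n + val3 d v))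
        = (\<Sum>u\<in>words T m. \<Sum>j\<in>vals n. mult3 n j * g (val3 d u * 3 ^ n + j))"
      by (rule sum.cong[OF refl], rule sum_words_val3)
    also have "\<dots> = (\<Sum>i\<in>vals m. mult3 m i * (\<Sum>j\<in>vals n. mult3 n j * g (i * 3 ^ n + j)))"
      by (rule sum_words_val3)
    finally show ?thesis by (simp only: sum_distrib_left mult.assoc)
  qed
  finally show ?thesis unfolding g_def .
qed

lemma S_nonneg: "S \<theta> n \<ge> 0"
  by (simp add: S_def sum_nonneg)

text \<open>Subadditivity moves the power inside the convolution, and each pair \<open>i\<close>,
  \<open>j\<close> feeds at most one \<open>k\<close>.\<close>

lemma S_add:
  assumes "0 < \<theta>" "\<theta> \<le> 1"
  shows "S \<theta> (m + n) \<le> S \<theta> m * S \<theta> n"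
proof -
  let ?I = "\<lambda>i j k. if i * 3 ^ n + j = k then 1 else (0::real)"
  let ?f = "\<lambda>i j. real (mult3 m i) powr \<theta> * real (mult3 n j) powr \<theta>"
  have "S \<theta> (m + n) \<le> (\<Sum>k\<in>vals (m + n). \<Sum>i\<in>vals m. \<Sum>j\<in>vals n. ?f i j * ?I i j k)"
    unfolding S_def
  proof (intro sum_mono)
    fix k
    have "real (mult3 (m + n) k) powr \<theta> \<le>
        (\<Sum>i\<in>vals m. (\<Sum>j\<in>vals n. real (mult3 m i) * real (mult3 n j) * ?I i j k) powr \<theta>)"
      unfolding mult3_add using assms by (intro sum_powr_le_powr_sum sum_nonneg) auto
    also have "\<dots> \<le> (\<Sum>i\<in>vals m. \<Sum>j\<in>vals n. (real (mult3 m i) * real (mult3 n j) * ?I i j k) powr \<theta>)"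
      using assms by (intro sum_mono sum_powr_le_powr_sum) auto
    also have "\<dots> = (\<Sum>i\<in>vals m. \<Sum>j\<in>vals n. ?f i j * ?I i j k)"
      by (intro sum.cong refl) (simp add: powr_mult)
    finally show "real (mult3 (m + n) k) powr \<theta> \<le> \<dots>" .
  qed
  also have "\<dots> = (\<Sum>i\<in>vals m. \<Sum>k\<in>vals (m + n). \<Sum>j\<in>vals n. ?f i j * ?I i j k)"
    by (rule sum.swap)
  also have "\<dots> = (\<Sum>i\<in>vals m. \<Sum>j\<in>vals n. \<Sum>k\<in>vals (m + n). ?f i j * ?I i j k)"
    by (rule sum.cong[OF refl]) (rule sum.swap)
  also have "\<dots> \<le> (\<Sum>i\<in>vals m. \<Sum>j\<in>vals n. ?f i j)"
  proof (intro sum_mono)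
    fix i j
    have "(\<Sum>k\<in>vals (m + n). ?I i j k) \<le> 1" by (simp add: finite_vals)
    then show "(\<Sum>k\<in>vals (m + n). ?f i j * ?I i j k) \<le> ?f i j"
      unfolding sum_distrib_left[symmetric] by (intro mult_left_le) auto
  qed
  also have "\<dots> = S \<theta> m * S \<theta> n" by (simp add: S_def sum_product)
  finally show ?thesis .
qed

lemma S_0: "S \<theta> 0 = 1"
proof -
  have W: "words T 0 = {[]}" by (auto simp: words_def)
  have "{w \<in> words T 0. val3 d w = 0} = {[]}" unfolding W by auto
  then have "mult3 0 0 = 1" unfolding mult3_def by simp
  moreover have "vals 0 = {0}" unfolding vals_def W by simp
  ultimately show ?thesis by (simp add: S_def)
qed

lemma S_mult:
  assumes "0 < \<theta>" "\<theta> \<le> 1"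
  shows "S \<theta> (n * j) \<le> S \<theta> n ^ j"
proof (induction j)
  case (Suc j)
  have "S \<theta> (n * Suc j) \<le> S \<theta> n * S \<theta> (n * j)" using S_add[OF assms, of n "n * j"] by simp
  also have "\<dots> \<le> S \<theta> n * S \<theta> n ^ j" using Suc by (intro mult_left_mono S_nonneg)
  finally show ?case by simp
qed (simp add: S_0)

text \<open>The right side is what Hoelder's inequality gives for \<open>3 ^ n\<close> positions,
  whereas the values are only known to lie below \<open>C * 3 ^ n\<close>. The mass on few residues
  pays for \<open>C\<close>: \<theta> is chosen close to 1 first, then \<open>n\<close>
  large.\<close>

lemma S_strict_bound:
  "\<exists>\<theta> n. 0 < \<theta> \<and> \<theta> < 1 \<and> n \<ge> 1 \<and> S \<theta> n < 3 ^ n * ((card T / 3) ^ n) powr \<theta>"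
proof -
  obtain q where q: "q > 0" "q < 1" and exc: "\<And>n. n \<ge> 1 \<Longrightarrow> \<exists>B\<subseteq>{..<3^n}.
     q\<^sup>2 * (real (card B) * n) \<le> 3 ^ n \<and>
     q * card T ^ n \<le> card {w \<in> words T n. val3 d w mod 3 ^ n \<in> B}"
    using exceptional_residues by blast
  obtain D where D: "\<And>t. t \<in> T \<Longrightarrow> d t \<le> D"
    using fin by (meson finite_nat_set_iff_bounded_le finite_imageI imageI)
  define C where "C = D + 1"
  have C: "real C \<ge> 1" by (simp add: C_def)
  \<comment> \<open>As \<theta> tends to 1 the cost \<open>C powr (1 - \<theta>)\<close> disappears
    and the left side tends to \<open>1 - q\<close>.\<close>
  have "\<exists>\<theta>. 0 < \<theta> \<and> \<theta> < 1 \<and> real C powr (1 - \<theta>) * (1 - q) powr \<theta> < 1 - q / 2"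
  proof -
    have "((\<lambda>\<theta>. real C powr (1 - \<theta>) * (1 - q) powr \<theta>) \<longlongrightarrow> real C powr (1 - 1) * (1 - q) powr 1)
      (at_left 1)"
      using C q by (intro tendsto_intros) auto
    moreover have "real C powr (1 - 1) * (1 - q) powr 1 < 1 - q / 2" using q C by simp
    ultimately have "eventually (\<lambda>\<theta>. real C powr (1 - \<theta>) * (1 - q) powr \<theta> < 1 - q / 2) (at_left 1)"
      by (rule order_tendstoD)
    moreover have "eventually (\<lambda>\<theta>::real. \<theta> \<in> {0<..<1}) (at_left 1)"
      by (rule eventually_at_left_real) simp
    ultimately have "eventually (\<lambda>\<theta>. \<theta> \<in> {0<..<1} \<and>
      real C powr (1 - \<theta>) * (1 - q) powr \<theta> < 1 - q / 2) (at_left 1)"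
      by eventually_elim auto
    from eventually_happens[OF this] show ?thesis by auto
  qed
  then obtain \<theta> where \<theta>: "0 < \<theta>" "\<theta> < 1" "real C powr (1 - \<theta>) * (1 - q) powr \<theta> < 1 - q / 2"
    by blast
  \<comment> \<open>With \<theta> fixed, this bounds the share of the exceptional values, whose
    density is of order \<open>1 / n\<close>.\<close>
  have "\<exists>n\<ge>1. (C / (q\<^sup>2 * real n)) powr (1 - \<theta>) < q / 2"
  proof -
    have "((\<lambda>n. (C / q\<^sup>2) * (1 / real n)) \<longlonglongrightarrow> (C / q\<^sup>2) * 0)"
      by (intro tendsto_intros lim_1_over_n)
    then have "((\<lambda>n. ((C / q\<^sup>2) * (1 / real n)) powr (1 - \<theta>)) \<longlonglongrightarrow> 0)"
      using \<theta> C q by (intro tendsto_zero_powrI[where b = "1 - \<theta>"] eventuallyI tendsto_const) auto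
    then have "eventually (\<lambda>n. ((C / q\<^sup>2) * (1 / real n)) powr (1 - \<theta>) < q / 2) sequentially"
      using q by (intro order_tendstoD) auto
    moreover have "eventually (\<lambda>n::nat. n \<ge> 1) sequentially" by (rule eventually_ge_at_top)
    ultimately have "eventually (\<lambda>n. n \<ge> 1 \<and> (C / (q\<^sup>2 * real n)) powr (1 - \<theta>) < q / 2) sequentially"
      by eventually_elim simp
    from eventually_happens[OF this] show ?thesis by auto
  qed
  then obtain n where n: "n \<ge> 1" "(C / (q\<^sup>2 * real n)) powr (1 - \<theta>) < q / 2" by blast
  obtain B where B: "B \<subseteq> {..<3^n}" "q\<^sup>2 * (real (card B) * n) \<le> 3 ^ n"
    "q * card T ^ n \<le> card {w \<in> words T n. val3 d w mod 3 ^ n \<in> B}"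
    using exc[OF n(1)] by blast
  define M where "M = real (card T ^ n)"
  have M: "M > 0" using card_pos by (simp add: M_def)
  define K1 where "K1 = {k\<in>vals n. k mod 3 ^ n \<in> B}"
  define K2 where "K2 = vals n - K1"
  have vals_sub: "vals n \<subseteq> {..<C * 3 ^ n}"
    using val3_less[OF D] by (auto simp: vals_def C_def)
  have finB: "finite B" using B(1) finite_subset by blast
  \<comment> \<open>A residue modulo \<open>3 ^ n\<close> has at most \<open>C\<close>
    representatives below \<open>C * 3 ^ n\<close>.\<close>
  have "K1 \<subseteq> (\<lambda>(r, j). r + j * 3 ^ n) ` (B \<times> {..<C})"
  proof
    fix k assume k: "k \<in> K1"
    then have "k < C * 3 ^ n" using vals_sub by (auto simp: K1_def)
    then have "k div 3 ^ n < C" by (simp add: less_mult_imp_div_less)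
    then show "k \<in> (\<lambda>(r, j). r + j * 3 ^ n) ` (B \<times> {..<C})"
      using k by (intro image_eqI[of _ _ "(k mod 3 ^ n, k div 3 ^ n)"]) (auto simp: K1_def mod_div_mult_eq)
  qed
  then have "card K1 \<le> card (B \<times> {..<C})"
    using finB by (intro surj_card_le) auto
  then have "card K1 \<le> card B * C" by (simp add: card_cartesian_product)
  then have "real (card K1) \<le> real (card B) * C" by (metis of_nat_le_iff of_nat_mult)
  also have "real (card B) \<le> 3 ^ n / (q\<^sup>2 * n)"
    using B(2) q n(1) by (simp add: field_simps)
  then have "real (card B) * C \<le> 3 ^ n / (q\<^sup>2 * n) * C" by (intro mult_right_mono) auto
  finally have card1: "real (card K1) \<le> 3 ^ n * (C / (q\<^sup>2 * n))" by (simp add: mult.commute)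
  have "card K2 \<le> card {..<C * 3 ^ n}"
    using vals_sub by (intro card_mono) (auto simp: K2_def)
  then have card2: "real (card K2) \<le> 3 ^ n * real C"
    by (simp only: card_lessThan flip: of_nat_le_iff[where ?'a = real]) (simp add: mult.commute)
  have total: "(\<Sum>k\<in>vals n. real (mult3 n k)) = M"
    using sum_words_val3[of "\<lambda>_. 1" n] by (simp add: M_def card_words fin)
  have sum1: "(\<Sum>k\<in>K1. real (mult3 n k)) = card {w \<in> words T n. val3 d w mod 3 ^ n \<in> B}"
  proof -
    have "real (card {w \<in> words T n. val3 d w mod 3 ^ n \<in> B}) =
        (\<Sum>w\<in>words T n. if val3 d w mod 3 ^ n \<in> B then 1 else 0)"
      by (simp add: sum.If_cases finite_words fin Int_def)
    also have "\<dots> = (\<Sum>k\<in>vals n. real (mult3 n k) * (if k mod 3 ^ n \<in> B then 1 else 0))"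
      by (rule sum_words_val3)
    also have "\<dots> = (\<Sum>k\<in>K1. real (mult3 n k))"
      unfolding K1_def by (subst sum.inter_filter) (auto simp: finite_vals intro!: sum.cong)
    finally show ?thesis by simp
  qed
  have split: "sum f (vals n) = sum f K1 + sum f K2" for f :: "nat \<Rightarrow> real"
    using sum.subset_diff[of K1 "vals n" f] finite_vals by (auto simp: K1_def K2_def)
  have pos2: "(\<Sum>k\<in>K2. real (mult3 n k)) \<ge> 0" by (simp add: sum_nonneg)
  have tot1: "(\<Sum>k\<in>K1. real (mult3 n k)) \<le> M"
    using split[of "\<lambda>k. real (mult3 n k)"] total pos2 by linarith
  have tot2: "(\<Sum>k\<in>K2. real (mult3 n k)) \<le> (1 - q) * M"
    using split[of "\<lambda>k. real (mult3 n k)"] total sum1 B(3) unfolding M_def by (simp add: algebra_simps)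
  have part: "(\<Sum>k\<in>K. real (mult3 n k) powr \<theta>) \<le> x powr (1 - \<theta>) * y powr \<theta>"
    if "K \<subseteq> vals n" "real (card K) \<le> x" "(\<Sum>k\<in>K. real (mult3 n k)) \<le> y" for K x y
  proof -
    have "(\<Sum>k\<in>K. real (mult3 n k) powr \<theta>) \<le>
        real (card K) powr (1 - \<theta>) * (\<Sum>k\<in>K. real (mult3 n k)) powr \<theta>"
      using \<theta> that(1) finite_vals by (intro sum_powr_le_card) (auto intro: finite_subset)
    also have "\<dots> \<le> x powr (1 - \<theta>) * y powr \<theta>"
      using that \<theta> by (intro mult_mono powr_mono2) (auto simp: sum_nonneg)
    finally show ?thesis .
  qed
  \<comment> \<open>\<open>K1\<close> has few values but possibly the whole mass; \<open>K2\<close>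
    may have most of the values but has at most the fraction \<open>1 - q\<close> of the
    mass.\<close>
  have "S \<theta> n = (\<Sum>k\<in>K1. real (mult3 n k) powr \<theta>) + (\<Sum>k\<in>K2. real (mult3 n k) powr \<theta>)"
    unfolding S_def by (rule split)
  also have "\<dots> \<le> (3 ^ n * (C / (q\<^sup>2 * n))) powr (1 - \<theta>) * M powr \<theta> +
      (3 ^ n * real C) powr (1 - \<theta>) * ((1 - q) * M) powr \<theta>"
    by (intro add_mono part card1 card2 tot1 tot2) (auto simp: K1_def K2_def)
  also have "\<dots> = (3 ^ n) powr (1 - \<theta>) * M powr \<theta> *
      ((C / (q\<^sup>2 * n)) powr (1 - \<theta>) + C powr (1 - \<theta>) * (1 - q) powr \<theta>)"
  proof -
    have e1: "(3 ^ n * (C / (q\<^sup>2 * n))) powr (1 - \<theta>) =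
        (3 ^ n) powr (1 - \<theta>) * (C / (q\<^sup>2 * n)) powr (1 - \<theta>)"
      by (rule powr_mult)
    have e2: "(3 ^ n * real C) powr (1 - \<theta>) = (3 ^ n) powr (1 - \<theta>) * real C powr (1 - \<theta>)"
      by (rule powr_mult)
    have e3: "((1 - q) * M) powr \<theta> = (1 - q) powr \<theta> * M powr \<theta>"
      by (rule powr_mult)
    show ?thesis unfolding e1 e2 e3 by (simp only: distrib_left mult_ac)
  qed
  also have "\<dots> < (3 ^ n) powr (1 - \<theta>) * M powr \<theta> * (q / 2 + (1 - q / 2))"
    using M n \<theta> by (intro mult_strict_left_mono add_strict_mono) auto
  also have "\<dots> = 3 ^ n * ((card T / 3) ^ n) powr \<theta>"
    using M by (simp add: M_def powr_diff powr_divide power_divide)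
  finally show ?thesis using \<theta> n by blast
qed

text \<open>The strict bound puts the quantity below 1 at \<open>p = 3 / card T\<close>; continuity
  from the right gains room beyond this value, and monotonicity in \<open>p\<close> covers
  everything smaller.\<close>

lemma S_contraction:
  "\<exists>\<theta> n p'. 0 < \<theta> \<and> \<theta> < 1 \<and> n \<ge> 1 \<and> p' > 3 / card T \<and>
     (\<forall>p. 0 < p \<and> p < p' \<longrightarrow> S \<theta> n / 3 ^ n * (p ^ n) powr \<theta> < 1)"
proof -
  obtain \<theta> n where \<theta>: "0 < \<theta>" "\<theta> < 1" and n: "n \<ge> 1"
    and S: "S \<theta> n < 3 ^ n * ((card T / 3) ^ n) powr \<theta>"
    using S_strict_bound by blast
  define f where "f p = S \<theta> n / 3 ^ n * (p ^ n) powr \<theta>" for p :: real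
  define p0 where "p0 = 3 / real (card T)"
  have p0: "p0 > 0" using card_pos by (simp add: p0_def)
  have "((card T / 3) ^ n) powr \<theta> = 1 / (p0 ^ n) powr \<theta>"
    by (simp add: p0_def power_divide powr_divide)
  moreover have v: "(p0 ^ n) powr \<theta> > 0" using p0 by simp
  ultimately have "S \<theta> n / 3 ^ n < 1 / (p0 ^ n) powr \<theta>" using S
    by (simp only: divide_less_eq) (simp add: mult.commute)
  then have "f p0 < 1" using v by (simp add: f_def less_divide_eq)
  moreover have "(f \<longlongrightarrow> f p0) (at_right p0)"
    unfolding f_def using p0 by (intro tendsto_intros) auto
  ultimately have "eventually (\<lambda>p. f p < 1) (at_right p0)" by (intro order_tendstoD)
  then obtain p' where p': "p' > p0" "\<And>p. p0 < p \<Longrightarrow> p < p' \<Longrightarrow> f p < 1"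
    unfolding eventually_at_right_field by blast
  \<comment> \<open>The midpoint becomes the threshold because monotonicity needs the bound at the
    threshold itself, and it is known only strictly below \<open>p'\<close>.\<close>
  have "f p < 1" if "0 < p" "p < (p0 + p') / 2" for p
  proof -
    have "f p \<le> f ((p0 + p') / 2)"
      unfolding f_def
    proof (rule mult_left_mono)
      show "(p ^ n) powr \<theta> \<le> (((p0 + p') / 2) ^ n) powr \<theta>"
      proof (rule powr_mono2)
        show "p ^ n \<le> ((p0 + p') / 2) ^ n" using that by (intro power_mono) auto
      qed (use \<theta> that in auto)
    qed (simp add: S_nonneg)
    also have "\<dots> < 1" using p' by (intro p'(2)) auto
    finally show ?thesis .
  qed
  then have "\<forall>p. 0 < p \<and> p < (p0 + p') / 2 \<longrightarrow> S \<theta> n / 3 ^ n * (p ^ n) powr \<theta> < 1"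
    unfolding f_def by blast
  moreover have "(p0 + p') / 2 > p0" using p'(1) by simp
  ultimately show ?thesis using \<theta> n unfolding p0_def by blast
qed

end

section \<open>Retained words and the geometry of the sponge\<close>

lemma card_third_coordinates:
  fixes t :: "real ^ 3"
  shows "card {i. t $ i = 1/3} = (if t $ 1 = 1/3 then 1 else 0) + (if t $ 2 = 1/3 then 1 else 0)
    + (if t $ 3 = 1/3 then 1 else 0)"
proof -
  have "card {i::3. t $ i = 1/3} = (\<Sum>i\<in>UNIV. if t $ i = 1/3 then 1 else 0)"
    by (simp add: sum.If_cases)
  then show ?thesis by (simp only: sum_3)
qed

text \<open>Triples of naturals replace real vectors so that the 27 candidates form an explicit
  list, which the simplifier can filter and count.\<close>

lemma finite_card_menger_digits: "finite menger_digits \<and> card menger_digits = 20"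
proof -
  define Q :: "nat \<times> nat \<times> nat \<Rightarrow> bool" where "Q = (\<lambda>(x, y, z).
    (if x = 1 then 1 else 0) + (if y = 1 then 1 else 0) + (if z = 1 then 1 else 0) < (2::nat))"
  define L where "L = filter Q (List.product [0,1,2] (List.product [0,1,2] [0,1,2]))"
  define v :: "nat \<times> nat \<times> nat \<Rightarrow> real ^ 3"
    where "v = (\<lambda>(x, y, z). vector [real x / 3, real y / 3, real z / 3])"
  have inj: "inj_on v (set L)"
    by (auto simp: inj_on_def v_def vec_eq_iff forall_3)
  have Q_v: "Q (x, y, z) \<longleftrightarrow> \<not> 2 \<le> card {i. v (x, y, z) $ i = 1/3}" for x y z
    unfolding card_third_coordinates by (simp add: Q_def v_def not_le)
  have "menger_digits = v ` set L"
  proof (intro set_eqI iffI)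
    fix t assume t: "t \<in> menger_digits"
    have "\<forall>i. \<exists>m\<in>set [0,1,2::nat]. t $ i = real m / 3"
      using t by (simp add: menger_digits_def)
    then obtain m where m: "\<And>i. m i \<in> set [0,1,2::nat]" "\<And>i. t $ i = real (m i) / 3" by metis
    have t_eq: "t = v (m 1, m 2, m 3)" by (simp add: v_def vec_eq_iff forall_3 m(2))
    then have "Q (m 1, m 2, m 3)" using t unfolding Q_v menger_digits_def by simp
    then have "(m 1, m 2, m 3) \<in> set L"
      unfolding L_def set_filter set_product using m(1) by blast
    then show "t \<in> v ` set L" using t_eq by blast
  next
    fix t assume "t \<in> v ` set L"
    then obtain x y z where xyz: "x \<in> set [0,1,2]" "y \<in> set [0,1,2]" "z \<in> set [0,1,2]"
        "Q (x, y, z)" and t: "t = v (x, y, z)"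
      unfolding L_def set_filter set_product by blast
    have third: "real k / 3 \<in> {0, 1/3, 2/3}" if "k \<in> set [0,1,2]" for k
      using that by auto
    have "t $ i \<in> {0, 1/3, 2/3}" for i
      using exhaust_3[of i] third[OF xyz(1)] third[OF xyz(2)] third[OF xyz(3)]
      unfolding t v_def case_prod_conv by (elim disjE) (simp_all only: vector_3)
    then show "t \<in> menger_digits" using xyz(4) t unfolding Q_v menger_digits_def by blast
  qed
  moreover have "card (set L) = 20"
  proof -
    have "distinct L" unfolding L_def by (intro distinct_filter distinct_product) simp_all
    moreover have "length L = 20" by (simp add: L_def Q_def)
    ultimately show ?thesis by (simp add: distinct_card)
  qed
  ultimately show ?thesis using card_image[OF inj] by (metis finite_imageI finite_set)
qed

section \<open>Survival probabilities of words and positions\<close>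

lemma menger_retained_eq:
  "menger_retained \<omega> n = {w \<in> words menger_digits n. \<forall>k\<in>{1..n}. \<omega> (take k w)}"
  by (auto simp: menger_retained_def words_def)

text \<open>The \<open>n\<close> nonempty prefixes of the word have different lengths, so survival
  asks for \<open>n\<close> distinct independent labels to be 1.\<close>

lemma emeasure_retained_word:
  assumes "0 < p" "p < 1" "w \<in> words menger_digits n"
  shows "{\<omega> \<in> space (menger_labels p). w \<in> menger_retained \<omega> n} \<in> sets (menger_labels p)"
    and "emeasure (menger_labels p) {\<omega> \<in> space (menger_labels p). w \<in> menger_retained \<omega> n}
      = ennreal (p ^ n)"
proof -
  interpret product_prob_space "\<lambda>_. measure_pmf (bernoulli_pmf p)" menger_words
    by unfold_locales
  define J where "J = (\<lambda>k. take k w) ` {1..n}"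
  have J: "J \<subseteq> menger_words" "finite J" "card J = n"
  proof -
    show "J \<subseteq> menger_words"
      using assms(3) set_take_subset[of _ w] by (fastforce simp: J_def menger_words_def words_def)
    have "inj_on (\<lambda>k. take k w) {1..n}"
      using assms(3) by (intro inj_on_inverseI[where g = length]) (auto simp: words_def)
    then show "card J = n" by (simp add: J_def card_image)
  qed (simp add: J_def)
  have eq: "{\<omega> \<in> space (menger_labels p). w \<in> menger_retained \<omega> n} =
      {\<omega> \<in> space (menger_labels p). \<forall>u\<in>J. \<omega> u \<in> {True}}"
    using assms(3) by (auto simp: menger_retained_eq J_def)
  show "{\<omega> \<in> space (menger_labels p). w \<in> menger_retained \<omega> n} \<in> sets (menger_labels p)"
    unfolding eq unfolding menger_labels_def using J
    by (intro sets.sets_Collect_finite_All sets_Collect_single') auto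
  have "emeasure (menger_labels p) {\<omega> \<in> space (menger_labels p). w \<in> menger_retained \<omega> n} =
      (\<Prod>u\<in>J. emeasure (measure_pmf (bernoulli_pmf p)) {True})"
    unfolding eq unfolding menger_labels_def using J by (intro emeasure_PiM_Collect) auto
  also have "\<dots> = ennreal (p ^ n)"
    using assms J by (simp add: emeasure_pmf_single ennreal_power)
  finally show "emeasure (menger_labels p) {\<omega> \<in> space (menger_labels p). w \<in> menger_retained \<omega> n}
      = ennreal (p ^ n)" .
qed

text \<open>A position survives with probability at most the smaller of 1 and the expected number of
  its surviving words, and this minimum is at most the latter raised to the power \<theta>. Summing
  over positions gives the moment.\<close>

lemma nn_integral_card_retained_vals:
  fixes d :: "real ^ 3 \<Rightarrow> nat" and n :: nat
  assumes "0 < p" "p < 1" "0 < \<theta>" "\<theta> \<le> 1" and dig: "digit_system menger_digits"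
  defines "X \<equiv> \<lambda>\<omega>. of_nat (card (val3 d ` menger_retained \<omega> n)) :: ennreal"
  shows "X \<in> borel_measurable (menger_labels p)"
    and "(\<integral>\<^sup>+\<omega>. X \<omega> \<partial>menger_labels p) \<le> ennreal (digit_system.S menger_digits d \<theta> n * (p ^ n) powr \<theta>)"
proof -
  interpret digit_system menger_digits d by (rule dig)
  interpret prob_space "menger_labels p"
    unfolding menger_labels_def by (intro prob_space_PiM measure_pmf.prob_space_axioms)
  let ?M = "menger_labels p"
  define E where "E w = {\<omega> \<in> space ?M. w \<in> menger_retained \<omega> n}" for w
  define H where "H k = (\<Union>w\<in>{w \<in> words menger_digits n. val3 d w = k}. E w)" for k
  have E: "E w \<in> sets ?M" "emeasure ?M (E w) = ennreal (p ^ n)" if "w \<in> words menger_digits n" for w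
    unfolding E_def using emeasure_retained_word[OF assms(1,2) that] by auto
  have finW: "finite (words menger_digits n)" by (simp add: finite_words fin)
  have H: "H k \<in> sets ?M" for k
    unfolding H_def using finW E(1) by (intro sets.finite_UN) auto
  have X_eq: "X \<omega> = (\<Sum>k\<in>vals n. indicator (H k) \<omega>)" if "\<omega> \<in> space ?M" for \<omega>
  proof -
    have "menger_retained \<omega> n \<subseteq> words menger_digits n" by (auto simp: menger_retained_eq)
    moreover have "\<omega> \<in> H k \<longleftrightarrow> k \<in> val3 d ` menger_retained \<omega> n" for k
      using that by (auto simp: H_def E_def menger_retained_eq)
    ultimately have "val3 d ` menger_retained \<omega> n = {k \<in> vals n. \<omega> \<in> H k}"
      unfolding vals_def by blast
    then have "X \<omega> = of_nat (card {k \<in> vals n. \<omega> \<in> H k})" by (simp add: X_def)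
    also have "\<dots> = (\<Sum>k\<in>vals n. indicator (H k) \<omega>)"
      by (simp add: indicator_def sum.If_cases finite_vals Int_def)
    finally show ?thesis .
  qed
  have meas: "(\<lambda>\<omega>. \<Sum>k\<in>vals n. indicator (H k) \<omega> :: ennreal) \<in> borel_measurable ?M"
    using H by (intro borel_measurable_sum borel_measurable_indicator)
  show "X \<in> borel_measurable ?M"
    using meas X_eq by (simp cong: measurable_cong)
  have prob_H: "emeasure ?M (H k) \<le> ennreal (real (mult3 n k) powr \<theta> * (p ^ n) powr \<theta>)" for k
  proof -
    define x where "x = real (mult3 n k) * p ^ n"
    have x: "x \<ge> 0" using assms by (simp add: x_def)
    have "emeasure ?M (H k) \<le> (\<Sum>w\<in>{w \<in> words menger_digits n. val3 d w = k}. emeasure ?M (E w))"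
      unfolding H_def using finW E(1) by (intro emeasure_subadditive_finite) auto
    also have "\<dots> = (\<Sum>w\<in>{w \<in> words menger_digits n. val3 d w = k}. ennreal (p ^ n))"
      by (intro sum.cong) (auto simp: E(2))
    also have "\<dots> = ennreal x"
      using assms(1) by (simp add: x_def mult3_def ennreal_mult ennreal_of_nat_eq_real_of_nat)
    finally have "emeasure ?M (H k) \<le> ennreal (min 1 x)"
      using emeasure_le_1[of "H k"] by (simp add: min_def)
    also have "min 1 x \<le> x powr \<theta>"
    proof (cases "x \<le> 1")
      case True
      then show ?thesis using powr_mono'[of \<theta> 1 x] assms x by simp
    next
      case False
      then show ?thesis using ge_one_powr_ge_zero[of x \<theta>] assms by simp
    qed
    also have "x powr \<theta> = real (mult3 n k) powr \<theta> * (p ^ n) powr \<theta>"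
      by (simp add: x_def powr_mult)
    finally show ?thesis by (simp add: ennreal_leI)
  qed
  have "(\<integral>\<^sup>+\<omega>. X \<omega> \<partial>?M) = (\<integral>\<^sup>+\<omega>. (\<Sum>k\<in>vals n. indicator (H k) \<omega>) \<partial>?M)"
    by (intro nn_integral_cong X_eq)
  also have "\<dots> = (\<Sum>k\<in>vals n. emeasure ?M (H k))"
    using H by (subst nn_integral_sum) auto
  also have "\<dots> \<le> (\<Sum>k\<in>vals n. ennreal (real (mult3 n k) powr \<theta> * (p ^ n) powr \<theta>))"
    by (intro sum_mono prob_H)
  also have "\<dots> = ennreal (S \<theta> n * (p ^ n) powr \<theta>)"
    by (subst sum_ennreal) (auto simp: S_def sum_distrib_right)
  finally show "(\<integral>\<^sup>+\<omega>. X \<omega> \<partial>?M) \<le> ennreal (S \<theta> n * (p ^ n) powr \<theta>)" .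
qed

section \<open>Projected words and interval covers\<close>

lemma proj3_menger_map: "proj3 a b c (menger_map t x) = proj3 a b c x / 3 + proj3 a b c t"
  by (simp add: proj3_def menger_map_def field_simps)

text \<open>The shift \<open>h\<close> of each digit adds the geometric sum
  \<open>h * (3 ^ n - 1) / 2\<close> to the value of a word of length \<open>n\<close>, which has to
  be subtracted again. After multiplication by \<open>3 ^ n\<close> the last translation has weight
  3, hence the factor 3 in the digit condition.\<close>

lemma proj3_menger_word_map:
  assumes d: "\<And>t. t \<in> menger_digits \<Longrightarrow> real (d t) = 3 * q * proj3 a b c t + h" and "q > 0"
    and "set w \<subseteq> menger_digits"
  shows "proj3 a b c (menger_word_map w x) =
    (proj3 a b c x + val3 d w / q - h * (3 ^ length w - 1) / (2 * q)) / 3 ^ length w"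
  using assms(3)
proof (induction w)
  case Nil
  then show ?case by (simp add: menger_word_map_def)
next
  case (Cons t w)
  have "menger_word_map (t # w) x = menger_map t (menger_word_map w x)"
    by (simp add: menger_word_map_def)
  moreover have "proj3 a b c t = (real (d t) - h) / (3 * q)"
    using d[of t] Cons.prems \<open>q > 0\<close> by (simp add: field_simps)
  ultimately have "proj3 a b c (menger_word_map (t # w) x) =
      (proj3 a b c x + val3 d w / q - h * (3 ^ length w - 1) / (2 * q)) / 3 ^ length w / 3
        + (real (d t) - h) / (3 * q)"
    using Cons by (simp add: proj3_menger_map)
  also have "\<dots> = (proj3 a b c x + val3 d (t # w) / q - h * (3 ^ length (t # w) - 1) / (2 * q)) /
      3 ^ length (t # w)"
    using \<open>q > 0\<close> by (simp add: field_simps)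
  finally show ?case .
qed

lemma abs_proj3_le:
  assumes "x \<in> cbox 0 1"
  shows "\<bar>proj3 a b c x\<bar> \<le> \<bar>a\<bar> + \<bar>b\<bar> + \<bar>c\<bar>"
proof -
  have "0 \<le> x $ i \<and> x $ i \<le> 1" for i using assms by (auto simp: mem_box_cart)
  then have "\<bar>y * x $ i\<bar> \<le> \<bar>y\<bar>" for y i by (auto simp: abs_mult intro!: mult_left_le)
  from this[of a 1] this[of b 2] this[of c 3] show ?thesis unfolding proj3_def by linarith
qed

text \<open>Rationality places all projected digits on one lattice: a common denominator makes them
  integers and a shift makes them nonnegative.\<close>

lemma rational_digit_values:
  assumes "a \<in> \<rat>" "b \<in> \<rat>" "c \<in> \<rat>"
  shows "\<exists>(d :: real ^ 3 \<Rightarrow> nat) (q :: real) h. q > 0 \<and>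
    (\<forall>t\<in>menger_digits. real (d t) = 3 * q * proj3 a b c t + h)"
proof -
  obtain A m where A: "a = of_int A / of_int m" "m > 0" using assms(1) by (auto elim: Rats_cases')
  obtain B n where B: "b = of_int B / of_int n" "n > 0" using assms(2) by (auto elim: Rats_cases')
  obtain C r where C: "c = of_int C / of_int r" "r > 0" using assms(3) by (auto elim: Rats_cases')
  define q where "q = m * n * r"
  define A' B' C' where "A' = A * n * r" and "B' = B * m * r" and "C' = C * m * n"
  have abc: "of_int q * a = of_int A'" "of_int q * b = of_int B'" "of_int q * c = of_int C'"
    using A(2) B(2) C(2) by (simp_all add: A(1) B(1) C(1) q_def A'_def B'_def C'_def)
  \<comment> \<open>The coordinates of \<open>3 * t\<close> are integers of absolute value at most
    2, so each of the three terms is at least -2 times the absolute value of its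
    coefficient.\<close>
  define h where "h = 2 * (\<bar>A'\<bar> + \<bar>B'\<bar> + \<bar>C'\<bar>)"
  have "\<exists>k::nat. real k = 3 * of_int q * proj3 a b c t + of_int h" if t: "t \<in> menger_digits" for t
  proof -
    have "\<exists>j::int. 3 * t $ i = of_int j \<and> \<bar>j\<bar> \<le> 2" for i
    proof -
      have "t $ i = 0 \<or> t $ i = 1/3 \<or> t $ i = 2/3" using t by (auto simp: menger_digits_def)
      then show ?thesis
        by (elim disjE) (rule exI[of _ 0] exI[of _ 1] exI[of _ 2], simp; fail)+
    qed
    then obtain j :: "3 \<Rightarrow> int" where j: "\<And>i. 3 * t $ i = of_int (j i)" "\<And>i. \<bar>j i\<bar> \<le> 2" by metis
    define s where "s = A' * j 1 + B' * j 2 + C' * j 3 + h"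
    have "\<bar>y * j i\<bar> \<le> 2 * \<bar>y\<bar>" for y i
      using mult_left_mono[OF j(2)[of i], of "\<bar>y\<bar>"] by (simp add: abs_mult mult.commute)
    then have bound: "0 \<le> y * j i + 2 * \<bar>y\<bar>" for y i
      by (smt (verit))
    have "s = (A' * j 1 + 2 * \<bar>A'\<bar>) + (B' * j 2 + 2 * \<bar>B'\<bar>) + (C' * j 3 + 2 * \<bar>C'\<bar>)"
      by (simp add: s_def h_def)
    then have "s \<ge> 0" by (simp only: add_nonneg_nonneg bound)
    moreover have "3 * of_int q * proj3 a b c t + of_int h = real_of_int s"
    proof -
      have "3 * of_int q * proj3 a b c t = (of_int q * a) * (3 * t $ 1) +
          (of_int q * b) * (3 * t $ 2) + (of_int q * c) * (3 * t $ 3)"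
        by (simp add: proj3_def algebra_simps)
      then show ?thesis by (simp add: abc j(1) s_def)
    qed
    ultimately show ?thesis by (intro exI[of _ "nat s"]) simp
  qed
  then obtain d :: "real ^ 3 \<Rightarrow> nat"
    where "\<And>t. t \<in> menger_digits \<Longrightarrow> real (d t) = 3 * of_int q * proj3 a b c t + of_int h"
    by metis
  moreover have "real_of_int q > 0" using A(2) B(2) C(2) by (simp add: q_def)
  ultimately show ?thesis by blast
qed

text \<open>The centre of the interval containing a projected cube depends only on the value of the
  word, so words with equal values share an interval. A Borel superset avoids the question whether
  the image is measurable.\<close>

lemma proj3_sponge_cover:
  assumes d: "\<And>t. t \<in> menger_digits \<Longrightarrow> real (d t) = 3 * q * proj3 a b c t + h" and "q > 0" "n \<ge> 1"
  shows "\<exists>U\<in>sets lborel. proj3 a b c ` random_menger_sponge \<omega> \<subseteq> U \<and>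
    emeasure lborel U \<le> ennreal (2 * (\<bar>a\<bar> + \<bar>b\<bar> + \<bar>c\<bar>) / 3 ^ n) *
      of_nat (card (val3 d ` menger_retained \<omega> n))"
proof -
  define L where "L = \<bar>a\<bar> + \<bar>b\<bar> + \<bar>c\<bar>"
  have L: "L \<ge> 0" by (simp add: L_def)
  define y where "y k = (real k / q - h * (3 ^ n - 1) / (2 * q)) / 3 ^ n" for k
  define I where "I k = {y k - L / 3 ^ n .. y k + L / 3 ^ n}" for k
  define K where "K = val3 d ` menger_retained \<omega> n"
  have finK: "finite K"
    using finite_words[of menger_digits n] finite_card_menger_digits
    by (auto simp: K_def menger_retained_eq)
  have cover: "proj3 a b c z \<in> (\<Union>k\<in>K. I k)" if mem: "z \<in> random_menger_sponge \<omega>" for z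
  proof -
    obtain w x where w: "w \<in> menger_retained \<omega> n" and x: "x \<in> cbox 0 1" and z: "z = menger_word_map w x"
      using \<open>n \<ge> 1\<close> mem unfolding random_menger_sponge_def by blast
    have "length w = n" "set w \<subseteq> menger_digits" using w by (auto simp: menger_retained_def)
    then have "proj3 a b c z = y (val3 d w) + proj3 a b c x / 3 ^ n"
      using proj3_menger_word_map[OF d \<open>q > 0\<close>, of w x] unfolding z y_def
      by (simp add: add_divide_distrib diff_divide_distrib)
    moreover have "\<bar>proj3 a b c x / 3 ^ n\<bar> \<le> L / 3 ^ n"
      using abs_proj3_le[OF x, of a b c] by (simp add: L_def divide_right_mono)
    ultimately have "proj3 a b c z \<in> I (val3 d w)"
      unfolding I_def atLeastAtMost_iff abs_le_iff by linarith
    then show ?thesis using w by (auto simp: K_def)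
  qed
  have "emeasure lborel (\<Union>k\<in>K. I k) \<le> (\<Sum>k\<in>K. emeasure lborel (I k))"
    using finK by (intro emeasure_subadditive_finite) (auto simp: I_def)
  also have "\<dots> = (\<Sum>k\<in>K. ennreal (2 * L / 3 ^ n))"
    using L by (intro sum.cong) (auto simp: I_def)
  also have "\<dots> = ennreal (2 * L / 3 ^ n) * of_nat (card K)"
    by (simp add: mult.commute)
  finally have "emeasure lborel (\<Union>k\<in>K. I k) \<le> ennreal (2 * L / 3 ^ n) * of_nat (card K)" .
  moreover have "(\<Union>k\<in>K. I k) \<in> sets lborel"
    using finK by (intro sets.finite_UN) (auto simp: I_def)
  ultimately show ?thesis using cover unfolding L_def K_def by blast
qed

section \<open>Almost sure nullity from decaying expected covers\<close>

theorem theorem1p16: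
  fixes a b c :: real
  assumes "a \<in> \<rat>" and "b \<in> \<rat>" and "c \<in> \<rat>"
  shows "\<exists>p'>3/20. \<forall>p. 0 < p \<and> p < 1 \<and> p < p' \<longrightarrow>
           (AE \<omega> in menger_labels p.
              proj3 a b c ` random_menger_sponge \<omega> \<in> null_sets lebesgue)"
proof -
  obtain d :: "real ^ 3 \<Rightarrow> nat" and q h :: real where "q > 0"
    and d: "\<And>t. t \<in> menger_digits \<Longrightarrow> real (d t) = 3 * q * proj3 a b c t + h"
    using rational_digit_values[OF assms] by blast
  interpret digit_system menger_digits d
    by unfold_locales (simp_all add: finite_card_menger_digits)
  obtain \<theta> n p' where \<theta>: "0 < \<theta>" "\<theta> < 1" and n: "n \<ge> 1" and p': "p' > 3 / 20"
    and contraction: "\<And>p. 0 < p \<Longrightarrow> p < p' \<Longrightarrow> S \<theta> n / 3 ^ n * (p ^ n) powr \<theta> < 1"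
    using S_contraction finite_card_menger_digits by auto
  define L where "L = 2 * (\<bar>a\<bar> + \<bar>b\<bar> + \<bar>c\<bar>)"
  have L: "L \<ge> 0" by (simp add: L_def)
  have "AE \<omega> in menger_labels p. proj3 a b c ` random_menger_sponge \<omega> \<in> null_sets lebesgue"
    if p: "0 < p" "p < 1" "p < p'" for p
  proof -
    let ?M = "menger_labels p"
    define \<rho> where "\<rho> = S \<theta> n / 3 ^ n * (p ^ n) powr \<theta>"
    have \<rho>: "0 \<le> \<rho>" "\<rho> < 1"
      using contraction[OF p(1,3)] by (auto simp: \<rho>_def S_nonneg)
    \<comment> \<open>At multiples of \<open>n\<close> submultiplicativity gives the geometric rate
      \<rho>; \<open>Suc\<close> skips level 0, which is absent from the intersection defining the
      sponge.\<close>
    define m where "m j = n * Suc j" for j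
    define X where "X j \<omega> = ennreal (L / 3 ^ m j) * of_nat (card (val3 d ` menger_retained \<omega> (m j)))" for j \<omega>
    have dig: "digit_system menger_digits" by (rule digit_system_axioms)
    note X_props = nn_integral_card_retained_vals[OF p(1,2) \<theta>(1) less_imp_le[OF \<theta>(2)] dig]
    have X_meas: "X j \<in> borel_measurable ?M" for j
      unfolding X_def by (intro borel_measurable_times_ennreal borel_measurable_const X_props(1))
    have X_int: "(\<integral>\<^sup>+\<omega>. X j \<omega> \<partial>?M) \<le> ennreal (L * \<rho> ^ Suc j)" for j
    proof -
      have pow: "(x ^ i) powr \<theta> = (x powr \<theta>) ^ i" if "x > 0" for x :: real and i
        using that by (induction i) (auto simp: powr_mult)
      have "(\<integral>\<^sup>+\<omega>. X j \<omega> \<partial>?M) \<le> ennreal (L / 3 ^ m j) * ennreal (S \<theta> (m j) * (p ^ m j) powr \<theta>)"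
        unfolding X_def using X_props by (subst nn_integral_cmult) (auto intro: mult_left_mono)
      also have "\<dots> = ennreal (L / 3 ^ m j * (S \<theta> (m j) * (p ^ m j) powr \<theta>))"
        using L by (intro ennreal_mult[symmetric]) (auto simp: S_nonneg)
      also have "\<dots> \<le> ennreal (L / 3 ^ m j * (S \<theta> n ^ Suc j * (p ^ m j) powr \<theta>))"
        using L S_mult[of \<theta> n "Suc j"] \<theta>
        by (intro ennreal_leI mult_left_mono mult_right_mono) (auto simp: m_def)
      also have "L / 3 ^ m j * (S \<theta> n ^ Suc j * (p ^ m j) powr \<theta>) = L * \<rho> ^ Suc j"
        using p(1) unfolding m_def \<rho>_def power_mult
        by (subst pow) (simp_all only: power_mult_distrib power_divide zero_less_power, simp)
      finally show ?thesis .
    qed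
    \<comment> \<open>The mean of the infimum is at most the mean of every \<open>X j\<close>, hence
      zero.\<close>
    have "(\<integral>\<^sup>+\<omega>. (INF j. X j \<omega>) \<partial>?M) \<le> ennreal (L * \<rho> ^ Suc j)" for j
      using X_int[of j] by (rule order_trans[OF nn_integral_mono, rotated]) (auto intro: INF_lower)
    moreover have "(\<lambda>j. ennreal (L * \<rho> ^ Suc j)) \<longlonglongrightarrow> ennreal (L * 0)"
      using \<rho> by (intro tendsto_intros tendsto_ennrealI LIMSEQ_Suc LIMSEQ_power_zero) auto
    ultimately have "(\<integral>\<^sup>+\<omega>. (INF j. X j \<omega>) \<partial>?M) \<le> ennreal (L * 0)"
      by (intro LIMSEQ_le_const) auto
    then have "AE \<omega> in ?M. (INF j. X j \<omega>) = 0"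
      using X_meas by (subst (asm) mult_zero_right, subst nn_integral_0_iff_AE[symmetric]) auto
    then show ?thesis
    proof (rule AE_mp, intro AE_I2 impI)
      fix \<omega> assume inf0: "(INF j. X j \<omega>) = 0"
      have "m j \<ge> 1" for j using n by (simp add: m_def)
      then have "\<exists>U\<in>sets lborel. proj3 a b c ` random_menger_sponge \<omega> \<subseteq> U \<and>
          emeasure lborel U \<le> X j \<omega>" for j
        unfolding X_def L_def by (intro proj3_sponge_cover[OF d \<open>q > 0\<close>])
      then have "\<exists>U. \<forall>j. U j \<in> sets lborel \<and> proj3 a b c ` random_menger_sponge \<omega> \<subseteq> U j \<and>
          emeasure lborel (U j) \<le> X j \<omega>"
        unfolding Bex_def by (intro choice allI)
      then obtain U where "\<forall>j. U j \<in> sets lborel \<and>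
          proj3 a b c ` random_menger_sponge \<omega> \<subseteq> U j \<and> emeasure lborel (U j) \<le> X j \<omega>" ..
      then have U: "\<And>j. U j \<in> sets lborel"
        "\<And>j. proj3 a b c ` random_menger_sponge \<omega> \<subseteq> U j" "\<And>j. emeasure lborel (U j) \<le> X j \<omega>"
        by simp_all
      \<comment> \<open>For a fixed outcome the covers have arbitrarily small measure, so their
        intersection is a Borel null set; completeness of Lebesgue measure then handles the
        image.\<close>
      have "emeasure lborel (\<Inter>j. U j) \<le> X j \<omega>" for j
      proof -
        have "emeasure lborel (\<Inter>j. U j) \<le> emeasure lborel (U j)"
          using U(1) by (intro emeasure_mono INT_lower UNIV_I)
        also note U(3)
        finally show ?thesis .
      qed
      then have "emeasure lborel (\<Inter>j. U j) \<le> 0" unfolding inf0[symmetric] by (rule INF_greatest)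
      then have "emeasure lborel (\<Inter>j. U j) = 0" by simp
      moreover have "(\<Inter>j. U j) \<in> sets lborel" using U(1) by (intro sets.countable_INT) auto
      ultimately have "(\<Inter>j. U j) \<in> null_sets lborel" by (rule null_setsI)
      then have "(\<Inter>j. U j) \<in> null_sets lebesgue" by (rule null_sets_completionI)
      with INT_greatest[OF U(2)]
      show "proj3 a b c ` random_menger_sponge \<omega> \<in> null_sets lebesgue"
        by (rule null_sets_completion_subset)
    qed
  qed
  then show ?thesis using p' by blast
qed

end
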